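(* Let $n,d\ge 1$ be integers with $n\ge d+1$. For every regular $X\in\mathbb{R}^{d\times n}$, $$|\mathcal M(X)| = 2\sum_{j=0}^{d-1}\binom{n-1}{j}.$$ In particular, this cardinality is the same for all regular $X$.
   Context: For $X=(x_1|\dots|x_n)\in\mathbb{R}^{d\times n}$ with columns $x_i\in\mathbb{R}^d$, put $H(X)=\operatorname{Conv}(x_1,\dots,x_n)$. For $\varepsilon\in\{\pm1\}^n$ put $\varepsilon X=(\varepsilon_1x_1|\dots|\varepsilon_nx_n)$, and define $\mathcal M(X)=\{\varepsilon\in\{\pm1\}^n: 0\notin H(\varepsilon X)\}$. The configuration $X$ is called regular if any $d$ of its columns (with distinct indices) are linearly independent. *)

theory Defs
  imports "HOL-Analysis.Analysis"
begin

(* A configuration of n vectors in R^d is a d x n matrix X :: real ^ 'n ^ 'd, with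
   n = CARD('n) and d = CARD('d); its vectors are the columns  column j X. *)

definition hull_of_columns :: "real ^ 'n ^ 'd \<Rightarrow> (real ^ 'd) set" where
  "hull_of_columns X = convex hull (range (\<lambda>j. column j X))"

definition sign_vectors :: "(real ^ 'n) set" where
  "sign_vectors = {\<epsilon>. \<forall>j. \<epsilon> $ j \<in> {-1, 1}}"

definition scale_columns :: "real ^ 'n \<Rightarrow> real ^ 'n ^ 'd \<Rightarrow> real ^ 'n ^ 'd" where
  "scale_columns \<epsilon> X = (\<chi> i j. \<epsilon> $ j * X $ i $ j)"

definition sign_patterns :: "real ^ 'n ^ 'd \<Rightarrow> (real ^ 'n) set" where
  "sign_patterns X = {\<epsilon> \<in> sign_vectors. 0 \<notin> hull_of_columns (scale_columns \<epsilon> X)}"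

(* Linear independence of the indexed family of columns: injectivity is required because
   independent only speaks about the set of columns and would not see repetitions. *)
definition regular_config :: "real ^ 'n ^ 'd \<Rightarrow> bool" where
  "regular_config X \<longleftrightarrow>
     (\<forall>J :: 'n set. card J = CARD('d) \<longrightarrow>
        inj_on (\<lambda>j. column j X) J \<and> independent ((\<lambda>j. column j X) ` J))"

lemma column_scale_columns: "column j (scale_columns \<epsilon> X) = \<epsilon> $ j *\<^sub>R column j X"
  by (simp add: column_def scale_columns_def vec_eq_iff)

end

theory Submission
  imports Defs
begin

text \<open>
  By separation, \<open>0\<close> lies outside the hull of the signed columns iff some \<open>w\<close> has positive inner
  product with all of them, so one counts the sign patterns of \<open>(w \<bullet> x\<^sub>i)\<^sub>i\<close>. When a new vector \<open>x\<^sub>a\<close>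
  is added, a pattern realized by \<open>w\<close> in a subspace \<open>S\<close> extends in one or two ways, and it extends in
  two ways iff it is already realized in \<open>S \<inter> x\<^sub>a\<^sup>\<bottom>\<close>. Hence \<open>C(n + 1, d) = C(n, d) + C(n, d - 1)\<close>,
  which is Pascal's rule for the claimed sum.
\<close>

section \<open>Sign patterns realized in a subspace, encoded by their positive indices\<close>

definition realizes :: "('i \<Rightarrow> 'a::euclidean_space) \<Rightarrow> 'a \<Rightarrow> 'i set \<Rightarrow> 'i set \<Rightarrow> bool" where
  "realizes x w I A \<longleftrightarrow> (\<forall>i\<in>I. if i \<in> A then 0 < w \<bullet> x i else w \<bullet> x i < 0)"

definition realized_patterns :: "('i \<Rightarrow> 'a::euclidean_space) \<Rightarrow> 'i set \<Rightarrow> 'a set \<Rightarrow> 'i set set" where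
  "realized_patterns x I S = {A. A \<subseteq> I \<and> (\<exists>w\<in>S. realizes x w I A)}"

text \<open>For finite \<open>I\<close> and a subspace \<open>S\<close> this says that the
  orthogonal projections to \<open>S\<close> of any at most \<open>dim S\<close> of the vectors are
  linearly independent as a family. Stating it through dimensions of sections of \<open>S\<close>
  lets it pass to a hyperplane of \<open>S\<close> without projecting the vectors.\<close>

definition general_position :: "('i \<Rightarrow> 'a::euclidean_space) \<Rightarrow> 'i set \<Rightarrow> 'a set \<Rightarrow> bool" where
  "general_position x I S \<longleftrightarrow>
     (\<forall>J\<subseteq>I. card J \<le> dim S \<longrightarrow> dim {w\<in>S. \<forall>j\<in>J. w \<bullet> x j = 0} + card J = dim S)"

text \<open>Finitely many strict inequalities survive a small change of \<open>w\<close>, and a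
  neighbourhood of 0 on the line contains both signs of the same step \<open>e\<close>.\<close>

lemma realizes_perturb:
  assumes "finite I" "realizes x w I A"
  obtains e where "e > 0" "realizes x (w + e *\<^sub>R v) I A" "realizes x (w - e *\<^sub>R v) I A"
proof -
  have "\<forall>\<^sub>F t in nhds 0. realizes x (w + t *\<^sub>R v) I A"
    unfolding realizes_def
  proof (intro eventually_ball_finite \<open>finite I\<close> ballI)
    fix i assume i: "i \<in> I"
    have "((\<lambda>t. (w + t *\<^sub>R v) \<bullet> x i) \<longlongrightarrow> (w + 0 *\<^sub>R v) \<bullet> x i) (nhds 0)"
      by (intro tendsto_intros filterlim_ident)
    then have lim: "((\<lambda>t. (w + t *\<^sub>R v) \<bullet> x i) \<longlongrightarrow> w \<bullet> x i) (nhds 0)"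
      by simp
    show "\<forall>\<^sub>F t in nhds 0. if i \<in> A then 0 < (w + t *\<^sub>R v) \<bullet> x i else (w + t *\<^sub>R v) \<bullet> x i < 0"
      using order_tendstoD[OF lim, of 0] assms(2) i
      by (cases "i \<in> A") (auto simp: realizes_def)
  qed
  then obtain d where "d > 0" and d: "\<And>t. dist t 0 < d \<Longrightarrow> realizes x (w + t *\<^sub>R v) I A"
    by (auto simp: eventually_nhds_metric)
  show thesis
    using \<open>d > 0\<close> d[of "d / 2"] d[of "- (d / 2)"] by (intro that[of "d / 2"]) auto
qed

text \<open>The realizers of one pattern form a convex cone. The weights are not normalized, so any
  positive pair that cancels a given coordinate can be used.\<close>

lemma realizes_convex:
  assumes "realizes x u I A" "realizes x v I A" "0 < p" "0 < q"
  shows "realizes x (p *\<^sub>R u + q *\<^sub>R v) I A"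
  using assms
  by (auto simp: realizes_def inner_add_left add_pos_pos add_neg_neg mult_pos_neg split: if_splits)

lemma realized_patterns_zero_space:
  assumes "I \<noteq> {}" "S \<subseteq> {0}"
  shows "realized_patterns x I S = {}"
  using assms by (force simp: realized_patterns_def realizes_def split: if_splits)

lemma realized_patterns_subset: "realized_patterns x I S \<subseteq> Pow I"
  by (auto simp: realized_patterns_def)

lemma finite_realized_patterns: "finite I \<Longrightarrow> finite (realized_patterns x I S)"
  by (rule finite_subset[OF realized_patterns_subset]) simp

text \<open>With \<open>P\<close> and \<open>N\<close> the patterns on \<open>I\<close> that extend
  by a positive and by a negative sign at \<open>a\<close>, the new count is
  \<open>card P + card N\<close>, which equals
  \<open>card (P \<union> N) + card (P \<inter> N)\<close>. The vector \<open>v\<close> ensures that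
  \<open>S\<close> has room on both sides of the hyperplane orthogonal to
  \<open>x a\<close>.\<close>

lemma card_realized_patterns_insert:
  assumes "finite I" "a \<notin> I" "subspace S" and v: "v \<in> S" "v \<bullet> x a \<noteq> 0"
  shows "card (realized_patterns x (insert a I) S)
    = card (realized_patterns x I S) + card (realized_patterns x I {w\<in>S. w \<bullet> x a = 0})"
proof -
  define P where "P = {A. A \<subseteq> I \<and> (\<exists>w\<in>S. realizes x w I A \<and> 0 < w \<bullet> x a)}"
  define N where "N = {A. A \<subseteq> I \<and> (\<exists>w\<in>S. realizes x w I A \<and> w \<bullet> x a < 0)}"
  obtain u where u: "u \<in> S" "0 < u \<bullet> x a"
  proof (cases "0 < v \<bullet> x a")
    case False
    then have "- v \<in> S" "0 < (- v) \<bullet> x a"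
      using v assms(3) by (auto simp: subspace_neg)
    then show ?thesis by (rule that)
  qed (use v that in blast)
  \<comment> \<open>A realizer on the hyperplane is tilted by a small multiple of \<open>u\<close>
    to either side without changing its pattern on \<open>I\<close>.\<close>
  have both: "A \<in> P \<and> A \<in> N" if A: "A \<subseteq> I" and w: "w \<in> S" "realizes x w I A" "w \<bullet> x a = 0" for A w
  proof -
    obtain e where "e > 0" "realizes x (w + e *\<^sub>R u) I A" "realizes x (w - e *\<^sub>R u) I A"
      using realizes_perturb[OF assms(1) w(2)] .
    moreover have "w + e *\<^sub>R u \<in> S" "w - e *\<^sub>R u \<in> S"
      using w u assms(3) by (auto intro: subspace_add subspace_diff subspace_scale)
    moreover have "0 < (w + e *\<^sub>R u) \<bullet> x a" "(w - e *\<^sub>R u) \<bullet> x a < 0"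
      using \<open>e > 0\<close> u w by (auto simp: inner_add_left inner_diff_left)
    ultimately show ?thesis
      using A unfolding P_def N_def by blast
  qed
  have un: "P \<union> N = realized_patterns x I S"
  proof
    show "P \<union> N \<subseteq> realized_patterns x I S"
      by (auto simp: P_def N_def realized_patterns_def)
    show "realized_patterns x I S \<subseteq> P \<union> N"
    proof
      fix A assume "A \<in> realized_patterns x I S"
      then obtain w where w: "A \<subseteq> I" "w \<in> S" "realizes x w I A"
        by (auto simp: realized_patterns_def)
      consider "w \<bullet> x a = 0" | "0 < w \<bullet> x a" | "w \<bullet> x a < 0" by linarith
      then show "A \<in> P \<union> N"
        using w both by cases (auto simp: P_def N_def)
    qed
  qed
  have int: "P \<inter> N = realized_patterns x I {w\<in>S. w \<bullet> x a = 0}"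
  proof
    show "realized_patterns x I {w\<in>S. w \<bullet> x a = 0} \<subseteq> P \<inter> N"
      using both by (auto simp: realized_patterns_def)
    show "P \<inter> N \<subseteq> realized_patterns x I {w\<in>S. w \<bullet> x a = 0}"
    proof
      fix A assume "A \<in> P \<inter> N"
      then obtain p q where A: "A \<subseteq> I"
        and p: "p \<in> S" "realizes x p I A" "0 < p \<bullet> x a"
        and q: "q \<in> S" "realizes x q I A" "q \<bullet> x a < 0"
        by (auto simp: P_def N_def)
      \<comment> \<open>The segment from \<open>p\<close> to \<open>q\<close> crosses the
        hyperplane. These weights are positive and make the two contributions to
        \<open>w \<bullet> x a\<close> cancel.\<close>
      define w where "w = (- (q \<bullet> x a)) *\<^sub>R p + (p \<bullet> x a) *\<^sub>R q"
      have "realizes x w I A"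
        unfolding w_def using p q by (intro realizes_convex) auto
      moreover have "w \<in> S"
        unfolding w_def using p q assms(3) by (intro subspace_add subspace_scale)
      moreover have "w \<bullet> x a = 0"
        by (simp add: w_def inner_add_left inner_diff_left)
      ultimately show "A \<in> realized_patterns x I {w\<in>S. w \<bullet> x a = 0}"
        using A by (auto simp: realized_patterns_def)
    qed
  qed
  have fin: "finite P" "finite N"
    using un finite_realized_patterns[OF assms(1), of x S] by (metis finite_Un)+
  have sub: "P \<subseteq> Pow I" "N \<subseteq> Pow I"
    by (auto simp: P_def N_def)
  have realizes_plus: "realizes x w (insert a I) (insert a A) \<longleftrightarrow> 0 < w \<bullet> x a \<and> realizes x w I A"
    for w A using assms(2) by (auto simp: realizes_def)
  have realizes_minus: "realizes x w (insert a I) A \<longleftrightarrow> w \<bullet> x a < 0 \<and> realizes x w I A"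
    if "A \<subseteq> I" for w A using assms(2) that by (auto simp: realizes_def)
  have split: "realized_patterns x (insert a I) S = insert a ` P \<union> N"
  proof
    show "insert a ` P \<union> N \<subseteq> realized_patterns x (insert a I) S"
      using realizes_plus realizes_minus by (fastforce simp: realized_patterns_def P_def N_def)
    show "realized_patterns x (insert a I) S \<subseteq> insert a ` P \<union> N"
    proof
      fix A assume "A \<in> realized_patterns x (insert a I) S"
      then obtain w where A: "A \<subseteq> insert a I" and w: "w \<in> S" "realizes x w (insert a I) A"
        by (auto simp: realized_patterns_def)
      show "A \<in> insert a ` P \<union> N"
      proof (cases "a \<in> A")
        case True
        then have eq: "A = insert a (A - {a})" by blast
        then have "A - {a} \<in> P"
          using A w realizes_plus[of w "A - {a}"] unfolding P_def by auto
        with eq show ?thesis by blast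
      next
        case False
        then have "A \<subseteq> I" using A by blast
        then have "A \<in> N"
          using w realizes_minus[of A w] unfolding N_def by auto
        then show ?thesis by blast
      qed
    qed
  qed
  have "card (realized_patterns x (insert a I) S) = card (insert a ` P) + card N"
    unfolding split using fin sub assms(2) by (intro card_Un_disjoint) auto
  also have "card (insert a ` P) = card P"
  proof (rule card_image, rule inj_onI)
    fix A B assume "A \<in> P" "B \<in> P" "insert a A = insert a B"
    moreover from this have "a \<notin> A" "a \<notin> B"
      using sub assms(2) by auto
    ultimately show "A = B" by (simp add: insert_ident)
  qed
  also have "card P + card N = card (P \<union> N) + card (P \<inter> N)"
    by (rule card_Un_Int[OF fin])
  finally show ?thesis by (simp add: un int)
qed

section \<open>General position and the closed formula\<close>

lemma general_position_subset:
  "general_position x I S \<Longrightarrow> J \<subseteq> I \<Longrightarrow> general_position x J S"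
  by (auto simp: general_position_def)

text \<open>A condition on \<open>J\<close> inside the hyperplane section is the condition on
  \<open>insert a J\<close> inside \<open>S\<close>: the number of constraints and the available
  dimension both grow by one.\<close>

lemma general_position_hyperplane:
  assumes "finite I" "a \<notin> I" "general_position x (insert a I) S" "dim S \<noteq> 0"
  shows "dim S = Suc (dim {w\<in>S. w \<bullet> x a = 0})"
    and "general_position x I {w\<in>S. w \<bullet> x a = 0}"
proof -
  have "card {a} \<le> dim S" using assms(4) by (simp del: dim_eq_0)
  then show *: "dim S = Suc (dim {w\<in>S. w \<bullet> x a = 0})"
    using assms(3)[unfolded general_position_def, rule_format, of "{a}"] by simp
  show "general_position x I {w\<in>S. w \<bullet> x a = 0}"
    unfolding general_position_def
  proof (intro allI impI)
    fix J assume J: "J \<subseteq> I" "card J \<le> dim {w\<in>S. w \<bullet> x a = 0}"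
    then have "finite J" "a \<notin> J" using assms(1,2) finite_subset by auto
    then have "card (insert a J) = Suc (card J)" by simp
    moreover have "{w \<in> {w\<in>S. w \<bullet> x a = 0}. \<forall>j\<in>J. w \<bullet> x j = 0}
        = {w\<in>S. \<forall>j\<in>insert a J. w \<bullet> x j = 0}" by auto
    moreover have "insert a J \<subseteq> insert a I" using J by auto
    ultimately show "dim {w \<in> {w\<in>S. w \<bullet> x a = 0}. \<forall>j\<in>J. w \<bullet> x j = 0} + card J
        = dim {w\<in>S. w \<bullet> x a = 0}"
      using * J assms(3)[unfolded general_position_def, rule_format, of "insert a J"] by simp
  qed
qed

text \<open>Pascal's rule summed over \<open>j\<close>. The term for \<open>j = 0\<close> has no
  lower neighbour, so the last sum is one term shorter.\<close>

lemma sum_choose_Suc: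
  "(\<Sum>j<Suc d. Suc m choose j) = (\<Sum>j<Suc d. m choose j) + (\<Sum>j<d. m choose j)"
  by (induction d) auto

text \<open>The induction keeps \<open>S\<close> arbitrary because the recursion passes to a
  hyperplane of \<open>S\<close>. The empty \<open>I\<close> is excluded: it has exactly one
  pattern, while truncated subtraction would make the formula give 2 as soon as
  \<open>dim S > 0\<close>.\<close>

lemma card_realized_patterns:
  assumes "finite I" "I \<noteq> {}" "subspace S" "general_position x I S"
  shows "card (realized_patterns x I S) = 2 * (\<Sum>j<dim S. (card I - 1) choose j)"
  using assms
proof (induction I arbitrary: S rule: finite_induct)
  case (insert a I)
  show ?case
  proof (cases "dim S = 0")
    \<comment> \<open>Only \<open>w = 0\<close> is available, which has no strict sign; the sum on
      the right is empty.\<close>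
    case True
    then show ?thesis
      using realized_patterns_zero_space[of "insert a I" S x] dim_eq_0[of S]
      by (simp del: dim_eq_0)
  next
    case False
    define T where "T = {w\<in>S. w \<bullet> x a = 0}"
    have dim: "dim S = Suc (dim T)" and gp: "general_position x I T"
      using general_position_hyperplane[OF insert.hyps insert.prems(3) False]
      by (simp_all add: T_def)
    have "T \<noteq> S" using dim by auto
    then obtain v where v: "v \<in> S" "v \<bullet> x a \<noteq> 0" by (auto simp: T_def)
    have T: "subspace T"
      using insert.prems(2) by (auto simp: T_def subspace_def inner_add_left)
    have rec: "card (realized_patterns x (insert a I) S)
        = card (realized_patterns x I S) + card (realized_patterns x I T)"
      unfolding T_def by (rule card_realized_patterns_insert[where v = v]) (fact insert.hyps insert.prems(2) v)+
    show ?thesis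
    proof (cases "I = {}")
      case True
      \<comment> \<open>A single vector is the true base case: the induction hypothesis says nothing
        about the empty set, whose one pattern is counted once for \<open>S\<close> and once for
        \<open>T\<close>.\<close>
      have "realized_patterns x {} S = {{}}" "realized_patterns x {} T = {{}}"
        using subspace_0[OF T] subspace_0[OF insert.prems(2)]
        by (auto simp: realized_patterns_def realizes_def)
      moreover have "(\<Sum>j<Suc d. 0 choose j) = 1" for d
        by (induction d) auto
      ultimately show ?thesis
        using rec True dim by simp
    next
      case False
      then obtain m where m: "card I = Suc m"
        using insert.hyps(1) by (metis card_0_eq not0_implies_Suc)
      have gp': "general_position x I S"
        using general_position_subset[OF insert.prems(3)] by auto
      show ?thesis
        using rec insert.IH[OF False insert.prems(2) gp'] insert.IH[OF False T gp]
          sum_choose_Suc[of m "dim T"] insert.hyps m dim by simp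
    qed
  qed
qed simp

section \<open>From matrices to realized patterns\<close>

lemma regular_config_general_position:
  fixes X :: "real ^ 'n ^ 'd"
  assumes "CARD('d::finite) \<le> CARD('n::finite)" "regular_config X"
  shows "general_position (\<lambda>j. column j X) UNIV UNIV"
  unfolding general_position_def
proof (intro allI impI)
  fix J :: "'n set"
  assume "card J \<le> dim (UNIV :: (real ^ 'd) set)"
  then have le: "card J \<le> CARD('d)" by simp
  \<comment> \<open>Regularity speaks only of sets of exactly d columns, so \<open>J\<close> is
    enlarged to such a set and independence is inherited; this uses that there are at least d
    columns.\<close>
  obtain K where K: "J \<subseteq> K" "card K = CARD('d)"
    using exists_subset_between[OF le assms(1)] by auto
  let ?c = "\<lambda>j. column j X"
  have "inj_on ?c K" "independent (?c ` K)"
    using assms(2) K(2) by (auto simp: regular_config_def)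
  then have J: "inj_on ?c J" "independent (?c ` J)"
    using inj_on_subset[OF _ K(1)] independent_mono[OF _ image_mono[OF K(1)]] by simp_all
  \<comment> \<open>The common solutions \<open>w\<close> form the orthogonal complement of the span
    of the columns in \<open>J\<close>, and that span has dimension \<open>card J\<close>.\<close>
  have "dim {y \<in> UNIV. \<forall>v\<in>span (?c ` J). orthogonal v y} + dim (span (?c ` J))
      = dim (UNIV :: (real ^ 'd) set)"
    by (rule dim_subspace_orthogonal_to_vectors) auto
  moreover have "dim (span (?c ` J)) = card J"
    using J by (simp add: dim_eq_card_independent card_image)
  moreover have "{y \<in> UNIV. \<forall>v\<in>span (?c ` J). orthogonal v y} = {w\<in>UNIV. \<forall>j\<in>J. w \<bullet> ?c j = 0}"
    by (auto simp: orthogonal_commute orthogonal_def[symmetric] span_base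
        intro: orthogonal_to_span)
  ultimately show "dim {w\<in>UNIV. \<forall>j\<in>J. w \<bullet> ?c j = 0} + card J = dim (UNIV :: (real ^ 'd) set)"
    by simp
qed

text \<open>The hull of a finite set is compact, so it can be strictly separated from 0; conversely
  an open halfspace containing \<open>A\<close> is convex, contains the hull and misses 0.\<close>

lemma zero_notin_convex_hull_iff:
  fixes A :: "'a::euclidean_space set"
  assumes "finite A"
  shows "0 \<notin> convex hull A \<longleftrightarrow> (\<exists>w. \<forall>a\<in>A. 0 < w \<bullet> a)"
proof
  assume "0 \<notin> convex hull A"
  then obtain w b where "0 < b" "\<forall>y\<in>convex hull A. b < w \<bullet> y"
    using separating_hyperplane_closed_0[of "convex hull A"] assms
    by (auto simp: compact_imp_closed finite_imp_compact_convex_hull)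
  then show "\<exists>w. \<forall>a\<in>A. 0 < w \<bullet> a"
    by (meson hull_inc order.strict_trans)
next
  assume "\<exists>w. \<forall>a\<in>A. 0 < w \<bullet> a"
  then obtain w where "\<forall>a\<in>A. 0 < w \<bullet> a" ..
  then have "convex hull A \<subseteq> {y. 0 < w \<bullet> y}"
    by (intro hull_minimal) (auto simp: convex_halfspace_gt)
  then show "0 \<notin> convex hull A" by auto
qed

lemma card_sign_patterns:
  fixes X :: "real ^ 'n ^ 'd"
  shows "card (sign_patterns X) = card (realized_patterns (\<lambda>j. column j X) UNIV UNIV)"
proof (rule bij_betw_same_card, rule bij_betwI)
  let ?f = "\<lambda>\<epsilon> :: real ^ 'n. {j. \<epsilon> $ j = 1}"
  let ?g = "\<lambda>A. \<chi> j. if j \<in> A then 1 else (- 1 :: real)"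
  \<comment> \<open>After separation, a sign -1 on a column merely reverses the inequality for the
    unsigned column, so the same \<open>w\<close> witnesses both sides.\<close>
  have mem: "\<epsilon> \<in> sign_patterns X \<longleftrightarrow> ?f \<epsilon> \<in> realized_patterns (\<lambda>j. column j X) UNIV UNIV"
    if \<epsilon>: "\<epsilon> \<in> sign_vectors" for \<epsilon>
  proof -
    have "0 < w \<bullet> (\<epsilon> $ j *\<^sub>R column j X)
        \<longleftrightarrow> (if \<epsilon> $ j = 1 then 0 < w \<bullet> column j X else w \<bullet> column j X < 0)" for w j
    proof -
      have "\<epsilon> $ j = 1 \<or> \<epsilon> $ j = - 1" using \<epsilon> by (auto simp: sign_vectors_def)
      then show ?thesis by auto
    qed
    then show ?thesis
      using \<epsilon> by (simp add: sign_patterns_def hull_of_columns_def zero_notin_convex_hull_iff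
          column_scale_columns realized_patterns_def realizes_def)
  qed
  have g: "?g A \<in> sign_vectors" "?f (?g A) = A" for A
    by (auto simp: sign_vectors_def)
  show "?f \<in> sign_patterns X \<rightarrow> realized_patterns (\<lambda>j. column j X) UNIV UNIV"
    using mem by (auto simp: sign_patterns_def)
  show "?g \<in> realized_patterns (\<lambda>j. column j X) UNIV UNIV \<rightarrow> sign_patterns X"
    using mem[OF g(1)] g(2) by auto
  show "?g (?f \<epsilon>) = \<epsilon>" if "\<epsilon> \<in> sign_patterns X" for \<epsilon>
  proof -
    have "\<epsilon> $ j = - 1 \<or> \<epsilon> $ j = 1" for j
      using that by (auto simp: sign_patterns_def sign_vectors_def)
    then show ?thesis by (simp add: vec_eq_iff) metis
  qed
  show "?f (?g A) = A" for A by (rule g(2))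
qed

theorem theorem5:
  assumes "CARD('n::finite) \<ge> CARD('d::finite) + 1"
  shows "(\<forall>X :: real ^ 'n ^ 'd. regular_config X \<longrightarrow>
            card (sign_patterns X) = 2 * (\<Sum>j = 0..CARD('d) - 1. (CARD('n) - 1) choose j))
       \<and> (\<forall>(X :: real ^ 'n ^ 'd) (Y :: real ^ 'n ^ 'd). regular_config X \<longrightarrow> regular_config Y \<longrightarrow>
            card (sign_patterns X) = card (sign_patterns Y))"
proof -
  have "0 < CARD('d)" by simp
  \<comment> \<open>The two ranges agree only because d is positive, since subtraction on naturals
    truncates.\<close>
  then have "{0..CARD('d) - 1} = {..<CARD('d)}"
    by (auto simp del: zero_less_card_finite)
  then have "card (sign_patterns X) = 2 * (\<Sum>j = 0..CARD('d) - 1. (CARD('n) - 1) choose j)"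
    if "regular_config X" for X :: "real ^ 'n ^ 'd"
    using card_realized_patterns[OF _ _ _ regular_config_general_position[OF _ that]] assms
    by (simp add: card_sign_patterns)
  then show ?thesis by simp
qed

end
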